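(* Let $G$ be a subgroup of an $n$-dimensional crystallographic group, let $N(G)$ be the normalizer of $G$ in the group of isometries of $\mathbb{R}^n$, and let $H,H'$ be subgroups of index $2$ in $G$ with $H'=H^{\alpha}=\alpha H\alpha^{-1}$ for some $\alpha\in N(G)$. (a) If $D$ is a fundamental domain of $G$ (so that $g\mapsto g(D)$ is a bijection from $G$ onto $\{g(D):g\in G\}$) and $\alpha(D)=D$, then the action of $\alpha$ on $\{g(D):g\in G\}$ is equivalent, via this bijection, to the action of $\alpha$ on $G$ by conjugation; that is, $\alpha(g(D))=(\alpha g\alpha^{-1})(D)$ for all $g\in G$. (b) Let $Y=\bigcup_{i\in I}Y_i$ be a complete set of right coset representatives of $H$ in $G$ (the $Y_i$ disjoint) and $J_i\leq H$ for $i\in I$. If $P=\{hJ_iY_i:i\in I,h\in H\}$ is the $(Y_i,J_i)-H$ partition of $G$ and $P'=\{h'J_i^{\alpha}Y_i^{\alpha}:i\in I,h'\in H'\}$ is the $(Y_i^{\alpha},J_i^{\alpha})-H'$ partition of $G$, then $P'=P^{\alpha}:=\{\alpha B\alpha^{-1}:B\in P\}$. Moreover, the coloring corresponding to $P$ is perfect if and only if the coloring corresponding to $P'$ is perfect. (c) With $P,P'$ as in (b), the action of $H$ on $P$ by left multiplication is equivalent to the action of $H'$ on $P'$ by left multiplication: the map $f:P\to P'$, $f(B)=\alpha B\alpha^{-1}$, is a bijection and, with the isomorphism $\phi:H\to H'$, $\phi(h)=\alpha h\alpha^{-1}$, one has $\phi(g)f(B)=f(gB)$ for all $g\in H$, $B\in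 P$. (Equivalently, the action of $H$ on the set of colors of a coloring corresponding to $P$ is equivalent to the action of $H'$ on the set of colors of a coloring corresponding to $P'$.)
   Context: For a subgroup $K$ or subset $S$ of $G$ and an isometry $\alpha$, $K^{\alpha}=\alpha K\alpha^{-1}$, $S^{\alpha}=\{\alpha s\alpha^{-1}:s\in S\}$. Given $H\leq G$, a complete set $Y$ of right coset representatives of $H$ in $G$ written as a disjoint union $Y=\bigcup_{i\in I}Y_i$, and subgroups $J_i\leq H$, the $(Y_i,J_i)-H$ partition of $G$ is the partition $\{hJ_iY_i:i\in I,h\in H\}$ of $G$; each block corresponds to a color. $G$ acts on partitions of $G$ by left multiplication, $gP=\{gB:B\in P\}$; the coloring corresponding to a partition $P$ is perfect if $gP=P$ for all $g\in G$. *)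

theory Defs
  imports "HOL-Analysis.Analysis" "HOL-Algebra.Group_Action" "HOL-Library.Disjoint_Sets"
begin

definition isom_group :: "(real^'n \<Rightarrow> real^'n) monoid"
  where "isom_group =
    \<lparr>carrier = {f. bij f \<and> (\<forall>x y. dist (f x) (f y) = dist x y)}, monoid.mult = (\<circ>), one = id\<rparr>"

abbreviation isom_sub :: "(real^'n \<Rightarrow> real^'n) set \<Rightarrow> (real^'n \<Rightarrow> real^'n) monoid"
  where "isom_sub G \<equiv> isom_group\<lparr>carrier := G\<rparr>"

lemma group_isom_group: "group (isom_group :: (real^'n \<Rightarrow> real^'n) monoid)"
proof (rule groupI)
  fix f :: "real^'n \<Rightarrow> real^'n"
  assume f: "f \<in> carrier isom_group"
  then have "bij f" and d: "\<And>x y. dist (f x) (f y) = dist x y"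
    by (auto simp: isom_group_def)
  have "dist (inv_into UNIV f x) (inv_into UNIV f y) = dist x y" for x y
    using d[of "inv_into UNIV f x" "inv_into UNIV f y"] \<open>bij f\<close>
    by (simp add: bij_is_surj surj_f_inv_f)
  moreover have "inv_into UNIV f \<circ> f = id"
    using \<open>bij f\<close> by (simp add: bij_is_inj)
  ultimately show "\<exists>g\<in>carrier isom_group. g \<otimes>\<^bsub>isom_group\<^esub> f = \<one>\<^bsub>isom_group\<^esub>"
    using \<open>bij f\<close> by (intro bexI[of _ "inv_into UNIV f"]) (auto simp: isom_group_def bij_imp_bij_inv)
qed (auto simp: isom_group_def bij_comp comp_assoc)

text \<open>Discrete cocompact groups of isometries. The type \<^typ>\<open>real^'n \<Rightarrow> real^'n\<close> carries the topology
  of pointwise convergence; on isometries it coincides with the compact-open topology.\<close>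

definition crystallographic :: "(real^'n \<Rightarrow> real^'n) set \<Rightarrow> bool"
  where "crystallographic \<Gamma> \<longleftrightarrow>
    subgroup \<Gamma> isom_group \<and> discrete \<Gamma> \<and> (\<exists>K. compact K \<and> (\<Union>g\<in>\<Gamma>. g ` K) = UNIV)"

text \<open>The definition admits both the convention of open and that of closed fundamental domains
  (in the latter case \<open>D = closure (interior D)\<close>); connectedness is not required.\<close>

definition fundamental_domain :: "(real^'n \<Rightarrow> real^'n) set \<Rightarrow> (real^'n) set \<Rightarrow> bool"
  where "fundamental_domain G D \<longleftrightarrow>
    interior D \<noteq> {} \<and>
    (\<forall>g\<in>G. \<forall>h\<in>G. g \<noteq> h \<longrightarrow> g ` interior D \<inter> h ` interior D = {}) \<and>
    (\<Union>g\<in>G. g ` closure D) = UNIV"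

definition conj_elt :: "('a, 'b) monoid_scheme \<Rightarrow> 'a \<Rightarrow> 'a \<Rightarrow> 'a"
  where "conj_elt E a x = a \<otimes>\<^bsub>E\<^esub> x \<otimes>\<^bsub>E\<^esub> inv\<^bsub>E\<^esub> a"

definition conj_set :: "('a, 'b) monoid_scheme \<Rightarrow> 'a \<Rightarrow> 'a set \<Rightarrow> 'a set"
  where "conj_set E a S = a <#\<^bsub>E\<^esub> S #>\<^bsub>E\<^esub> inv\<^bsub>E\<^esub> a"

definition complete_right_coset_reps :: "('a, 'b) monoid_scheme \<Rightarrow> 'a set \<Rightarrow> 'a set \<Rightarrow> bool"
  where "complete_right_coset_reps G H Y \<longleftrightarrow>
    Y \<subseteq> carrier G \<and> (\<forall>C\<in>rcosets\<^bsub>G\<^esub> H. \<exists>!y. y \<in> Y \<and> y \<in> C)"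

definition coset_partition_data ::
    "('a, 'b) monoid_scheme \<Rightarrow> 'a set \<Rightarrow> 'i set \<Rightarrow> ('i \<Rightarrow> 'a set) \<Rightarrow> ('i \<Rightarrow> 'a set) \<Rightarrow> bool"
  where "coset_partition_data G H I Y J \<longleftrightarrow>
    complete_right_coset_reps G H (\<Union>i\<in>I. Y i) \<and> disjoint_family_on Y I \<and>
    (\<forall>i\<in>I. subgroup (J i) (G\<lparr>carrier := H\<rparr>))"

text \<open>If some \<open>Y i\<close> is empty, then the family below contains the empty set besides the blocks of the
  partition; the \<open>Y i\<close> are nevertheless not required to be nonempty.\<close>

definition coset_partition ::
    "('a, 'b) monoid_scheme \<Rightarrow> 'a set \<Rightarrow> 'i set \<Rightarrow> ('i \<Rightarrow> 'a set) \<Rightarrow> ('i \<Rightarrow> 'a set) \<Rightarrow> 'a set set"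
  where "coset_partition G H I Y J = {h <#\<^bsub>G\<^esub> (J i <#>\<^bsub>G\<^esub> Y i) | i h. i \<in> I \<and> h \<in> H}"

definition perfect :: "('a, 'b) monoid_scheme \<Rightarrow> 'a set set \<Rightarrow> bool"
  where "perfect G P \<longleftrightarrow> (\<forall>g\<in>carrier G. (\<lambda>B. g <#\<^bsub>G\<^esub> B) ` P = P)"

definition color_class :: "('a, 'b) monoid_scheme \<Rightarrow> ('a \<Rightarrow> 'c) \<Rightarrow> 'c \<Rightarrow> 'a set"
  where "color_class G c k = {x \<in> carrier G. c x = k}"

definition coloring_of :: "('a, 'b) monoid_scheme \<Rightarrow> 'a set set \<Rightarrow> ('a \<Rightarrow> 'c) \<Rightarrow> bool"
  where "coloring_of G P c \<longleftrightarrow> color_class G c ` (c ` carrier G) = P"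

text \<open>Restricted to \<open>P\<close> as required by \<^const>\<open>BijGroup\<close>.\<close>

definition left_mult_action :: "('a, 'b) monoid_scheme \<Rightarrow> 'a set set \<Rightarrow> 'a \<Rightarrow> 'a set \<Rightarrow> 'a set"
  where "left_mult_action G P = (\<lambda>g. \<lambda>B\<in>P. g <#\<^bsub>G\<^esub> B)"

definition color_action :: "('a, 'b) monoid_scheme \<Rightarrow> ('a \<Rightarrow> 'c) \<Rightarrow> 'a \<Rightarrow> 'c \<Rightarrow> 'c"
  where "color_action G c = (\<lambda>g. \<lambda>k\<in>c ` carrier G.
    THE k'. k' \<in> c ` carrier G \<and> color_class G c k' = g <#\<^bsub>G\<^esub> color_class G c k)"

definition equivalent_actions_via ::
    "('a, 'r) monoid_scheme \<Rightarrow> 'x set \<Rightarrow> ('a \<Rightarrow> 'x \<Rightarrow> 'x) \<Rightarrow>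
     ('b, 's) monoid_scheme \<Rightarrow> 'y set \<Rightarrow> ('b \<Rightarrow> 'y \<Rightarrow> 'y) \<Rightarrow> ('a \<Rightarrow> 'b) \<Rightarrow> ('x \<Rightarrow> 'y) \<Rightarrow> bool"
  where "equivalent_actions_via A X a B Z b \<phi> f \<longleftrightarrow>
    group_action A X a \<and> group_action B Z b \<and> \<phi> \<in> iso A B \<and> bij_betw f X Z \<and>
    (\<forall>g\<in>carrier A. \<forall>x\<in>X. b (\<phi> g) (f x) = f (a g x))"

end

theory Submission
  imports Defs
begin

text \<open>Conjugation by \<open>\<alpha>\<close> is an automorphism of \<open>G\<close> carrying \<open>H\<close> to \<open>H'\<close>, and the construction of the
  partition, perfectness and left multiplication are all natural with respect to group isomorphisms.
  The action on colors is the action on blocks transported along the bijection sending a color to its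
  color class. In (a), freeness of the action on the translates of \<open>D\<close> comes from comparing interiors,
  which isometries preserve.\<close>

section \<open>Equivalence of actions\<close>

text \<open>Only the source has to be known as an action: on \<open>Z\<close> the map
  \<open>b (\<phi> g)\<close> equals \<open>f\<close> after \<open>a g\<close> after the inverse of
  \<open>f\<close>, so bijectivity and multiplicativity are inherited by \<open>b\<close>.
  Extensionality is a separate premise because the elements of \<open>BijGroup Z\<close> are
  normalized outside \<open>Z\<close>, where the intertwining equation says nothing.\<close>

lemma equivalent_actions_viaI:
  assumes act: "group_action A X a" and B: "group B"
    and \<phi>: "\<phi> \<in> iso A B" and f: "bij_betw f X Z"
    and ext: "\<And>g. g \<in> carrier B \<Longrightarrow> b g \<in> extensional Z"
    and eq: "\<And>g x. g \<in> carrier A \<Longrightarrow> x \<in> X \<Longrightarrow> b (\<phi> g) (f x) = f (a g x)"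
  shows "equivalent_actions_via A X a B Z b \<phi> f"
proof -
  interpret act: group_action A X a by fact
  have surj_\<phi>: "\<exists>g\<in>carrier A. k = \<phi> g" if "k \<in> carrier B" for k
    using \<phi> that by (auto simp: iso_def bij_betw_def)
  have bij: "b k \<in> Bij Z" if k: "k \<in> carrier B" for k
  proof -
    obtain g where g: "g \<in> carrier A" "k = \<phi> g" using surj_\<phi>[OF k] by blast
    have "bij_betw (f \<circ> a g \<circ> inv_into X f) Z Z"
      using act.bij_prop0[OF g(1)] f bij_betw_inv_into[OF f]
      by (auto simp: Bij_def intro!: bij_betw_trans)
    moreover have "(f \<circ> a g \<circ> inv_into X f) z = b k z" if "z \<in> Z" for z
    proof -
      have "inv_into X f z \<in> X" "f (inv_into X f z) = z"
        using f that by (auto simp: bij_betw_def inv_into_into f_inv_into_f)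
      then show ?thesis using eq[OF g(1), of "inv_into X f z"] g(2) by simp
    qed
    ultimately have "bij_betw (b k) Z Z" using bij_betw_cong by blast
    then show ?thesis using ext[OF k] by (simp add: Bij_def)
  qed
  have "b (k \<otimes>\<^bsub>B\<^esub> l) = compose Z (b k) (b l)" if kl: "k \<in> carrier B" "l \<in> carrier B" for k l
  proof (rule extensionalityI[of _ Z])
    have kl': "k \<otimes>\<^bsub>B\<^esub> l \<in> carrier B" using B kl by (simp add: group.is_monoid monoid.m_closed)
    show "b (k \<otimes>\<^bsub>B\<^esub> l) \<in> extensional Z" using ext[OF kl'] .
    show "compose Z (b k) (b l) \<in> extensional Z" by simp
    fix z assume z: "z \<in> Z"
    then obtain x where x: "x \<in> X" "z = f x" using f by (auto simp: bij_betw_def)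
    obtain g h where gh: "g \<in> carrier A" "k = \<phi> g" "h \<in> carrier A" "l = \<phi> h"
      using surj_\<phi> kl by metis
    \<comment> \<open>Both factors are pulled back along \<open>\<phi>\<close>, so that the
      composition rule of the action \<open>a\<close> yields the one for \<open>b\<close>.\<close>
    have "\<phi> (g \<otimes>\<^bsub>A\<^esub> h) = k \<otimes>\<^bsub>B\<^esub> l" using \<phi> gh by (simp add: iso_def hom_mult)
    then have "b (k \<otimes>\<^bsub>B\<^esub> l) z = f (a (g \<otimes>\<^bsub>A\<^esub> h) x)"
      using eq[of "g \<otimes>\<^bsub>A\<^esub> h" x] x gh act.group_hom
      by (metis group.is_monoid group_hom_def monoid.m_closed)
    also have "\<dots> = f (a g (a h x))" using act.composition_rule x gh by simp
    also have "\<dots> = b k (b l z)"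
      using eq x gh act.element_image[OF gh(3) x(1) refl] by simp
    finally show "b (k \<otimes>\<^bsub>B\<^esub> l) z = compose Z (b k) (b l) z" using z by (simp add: compose_eq)
  qed
  then have "b \<in> hom B (BijGroup Z)"
    using bij by (auto simp: hom_def BijGroup_def)
  then have "group_action B Z b"
    using B by (simp add: group_action_def group_hom_def group_hom_axioms_def group_BijGroup)
  then show ?thesis using assms by (simp add: equivalent_actions_via_def)
qed

text \<open>Closure under all of \<open>H\<close> includes closure under inverses, and translation
  by \<open>inv h\<close> undoes translation by \<open>h\<close>; hence each translation permutes
  \<open>P\<close>. Associativity of translation gives the homomorphism property.\<close>

lemma (in group) group_action_left_mult:
  assumes H: "subgroup H G" and P: "\<And>B. B \<in> P \<Longrightarrow> B \<subseteq> carrier G"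
    and closed: "\<And>h B. h \<in> H \<Longrightarrow> B \<in> P \<Longrightarrow> h <# B \<in> P"
  shows "group_action (G\<lparr>carrier := H\<rparr>) P (left_mult_action G P)"
proof -
  have HG: "h \<in> carrier G" if "h \<in> H" for h using subgroup.mem_carrier[OF H that] .
  have inv: "inv h <# (h <# B) = B" "h <# (inv h <# B) = B" if "h \<in> H" "B \<in> P" for h B
    using P[OF that(2)] HG[OF that(1)] by (simp_all add: lcos_m_assoc lcos_mult_one)
  have bij: "left_mult_action G P h \<in> Bij P" if h: "h \<in> H" for h
  proof -
    have ih: "inv h \<in> H" using H h by (rule subgroup.m_inv_closed)
    have "bij_betw (\<lambda>B\<in>P. h <# B) P P"
      by (rule bij_betw_byWitness[where f' = "\<lambda>B. inv h <# B"])
        (use closed[OF h] closed[OF ih] inv[OF h] in auto)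
    then show ?thesis by (simp add: left_mult_action_def Bij_def)
  qed
  moreover have "left_mult_action G P (g \<otimes> h) = compose P (left_mult_action G P g) (left_mult_action G P h)"
    if "g \<in> H" "h \<in> H" for g h
    using that closed P HG
    by (auto simp: left_mult_action_def compose_def lcos_m_assoc intro!: restrict_ext)
  ultimately have "left_mult_action G P \<in> hom (G\<lparr>carrier := H\<rparr>) (BijGroup P)"
    by (auto simp: hom_def BijGroup_def)
  then show ?thesis
    using H by (simp add: group_action_def group_hom_def group_hom_axioms_def group_BijGroup
        subgroup_imp_group)
qed

section \<open>Colorings and their color classes\<close>

text \<open>An attained color has a nonempty class, and any point of the class determines the color,
  so distinct colors have distinct classes. Surjectivity onto \<open>P\<close> is the content of
  \<open>coloring_of\<close>.\<close>

lemma bij_betw_color_class: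
  assumes "coloring_of G P c"
  shows "bij_betw (color_class G c) (c ` carrier G) P"
proof -
  have "inj_on (color_class G c) (c ` carrier G)"
    by (rule inj_onI) (auto simp: color_class_def)
  then show ?thesis using assms by (simp add: coloring_of_def bij_betw_def)
qed

lemma color_class_color_action:
  assumes c: "coloring_of G P c" and k: "k \<in> c ` carrier G"
    and P: "g <#\<^bsub>G\<^esub> color_class G c k \<in> P"
  shows "color_action G c g k \<in> c ` carrier G"
    and "color_class G c (color_action G c g k) = g <#\<^bsub>G\<^esub> color_class G c k"
proof -
  \<comment> \<open>The definite description is the inverse of the bijection between colors and
    classes, evaluated at the translated class; it is meaningful because that translate is again a
    block.\<close>
  have eq: "color_action G c g k =
      the_inv_into (c ` carrier G) (color_class G c) (g <#\<^bsub>G\<^esub> color_class G c k)"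
    using k by (simp add: color_action_def the_inv_into_def)
  note bij = bij_betw_color_class[OF c]
  show "color_action G c g k \<in> c ` carrier G"
    unfolding eq using bij P by (metis bij_betw_def order_refl the_inv_into_into)
  show "color_class G c (color_action G c g k) = g <#\<^bsub>G\<^esub> color_class G c k"
    unfolding eq using bij P by (metis bij_betw_def f_the_inv_into_f)
qed

text \<open>A color \<open>k\<close> is sent to the color whose class is the image under
  \<open>f\<close> of the class of \<open>k\<close>. Since the transport rule needs an action at its
  source, the argument first carries the action on \<open>P\<close> to the colors of
  \<open>c\<close>, then goes on to the colors of \<open>c'\<close>.\<close>

lemma equivalent_color_actions:
  assumes eqv: "equivalent_actions_via (G\<lparr>carrier := H\<rparr>) P (left_mult_action G P)
      (G'\<lparr>carrier := H'\<rparr>) P' (left_mult_action G' P') \<phi> f"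
    and c: "coloring_of G P c" and c': "coloring_of G' P' c'"
  shows "\<exists>F. equivalent_actions_via (G\<lparr>carrier := H\<rparr>) (c ` carrier G) (color_action G c)
      (G'\<lparr>carrier := H'\<rparr>) (c' ` carrier G') (color_action G' c') \<phi> F"
proof -
  let ?C = "c ` carrier G" and ?C' = "c' ` carrier G'"
  let ?\<kappa> = "color_class G c" and ?\<kappa>' = "color_class G' c'"
  note \<kappa> = bij_betw_color_class[OF c] and \<kappa>' = bij_betw_color_class[OF c']
  have act: "group_action (G\<lparr>carrier := H\<rparr>) P (left_mult_action G P)"
    and act': "group_action (G'\<lparr>carrier := H'\<rparr>) P' (left_mult_action G' P')"
    and \<phi>: "\<phi> \<in> iso (G\<lparr>carrier := H\<rparr>) (G'\<lparr>carrier := H'\<rparr>)" and f: "bij_betw f P P'"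
    and eq: "\<And>g B. g \<in> H \<Longrightarrow> B \<in> P \<Longrightarrow> left_mult_action G' P' (\<phi> g) (f B) = f (left_mult_action G P g B)"
    using eqv by (auto simp: equivalent_actions_via_def)
  have grp: "group (G\<lparr>carrier := H\<rparr>)" and grp': "group (G'\<lparr>carrier := H'\<rparr>)"
    using act act' by (simp_all add: group_action_def group_hom_def)
  have \<kappa>P: "?\<kappa> k \<in> P" if "k \<in> ?C" for k using bij_betwE[OF \<kappa>] that by blast
  have closed: "g <#\<^bsub>G\<^esub> B \<in> P" if "g \<in> H" "B \<in> P" for g B
    using group_action.element_image[OF act, of g B] that by (simp add: left_mult_action_def)
  have closed': "g <#\<^bsub>G'\<^esub> B \<in> P'" if "g \<in> H'" "B \<in> P'" for g B
    using group_action.element_image[OF act', of g B] that by (simp add: left_mult_action_def)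
  let ?inv = "the_inv_into ?C ?\<kappa>"
  \<comment> \<open>Transport along the identity of the acting group and the map from blocks to
    colors shows that \<open>color_action G c\<close> is a group action.\<close>
  have "equivalent_actions_via (G\<lparr>carrier := H\<rparr>) P (left_mult_action G P)
      (G\<lparr>carrier := H\<rparr>) ?C (color_action G c) (\<lambda>g. g) ?inv"
  proof (rule equivalent_actions_viaI[OF act grp])
    show "(\<lambda>g. g) \<in> iso (G\<lparr>carrier := H\<rparr>) (G\<lparr>carrier := H\<rparr>)"
      by (simp add: iso_def hom_def bij_betw_def)
    show "bij_betw ?inv P ?C" using \<kappa> by (rule bij_betw_the_inv_into)
    show "color_action G c g \<in> extensional ?C" for g by (simp add: color_action_def)
    fix g B assume gB: "g \<in> carrier (G\<lparr>carrier := H\<rparr>)" "B \<in> P"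
    then have "?\<kappa> (?inv B) = B" "?inv B \<in> ?C"
      using \<kappa> by (metis bij_betw_def f_the_inv_into_f, metis bij_betw_def order_refl the_inv_into_into)
    then show "color_action G c g (?inv B) = ?inv (left_mult_action G P g B)"
      using gB by (simp add: color_action_def left_mult_action_def the_inv_into_def)
  qed
  then have actC: "group_action (G\<lparr>carrier := H\<rparr>) ?C (color_action G c)"
    by (simp add: equivalent_actions_via_def)
  let ?F = "the_inv_into ?C' ?\<kappa>' \<circ> (f \<circ> ?\<kappa>)"
  have F: "bij_betw ?F ?C ?C'"
    by (intro bij_betw_trans[OF bij_betw_trans[OF \<kappa> f]] bij_betw_the_inv_into \<kappa>')
  have \<kappa>'F: "?\<kappa>' (?F k) = f (?\<kappa> k)" if "k \<in> ?C" for k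
    using \<kappa>' bij_betwE[OF f] \<kappa>P[OF that] by (metis bij_betw_def comp_apply f_the_inv_into_f)
  have "equivalent_actions_via (G\<lparr>carrier := H\<rparr>) ?C (color_action G c)
      (G'\<lparr>carrier := H'\<rparr>) ?C' (color_action G' c') \<phi> ?F"
  proof (rule equivalent_actions_viaI[OF actC grp' \<phi> F])
    show "color_action G' c' g \<in> extensional ?C'" for g by (simp add: color_action_def)
    fix g k assume "g \<in> carrier (G\<lparr>carrier := H\<rparr>)" and k: "k \<in> ?C"
    then have g: "g \<in> H" by simp
    have \<phi>g: "\<phi> g \<in> H'" using \<phi> g by (auto simp: iso_def hom_def)
    have Fk: "?F k \<in> ?C'" using bij_betwE[OF F] k by blast
    have fB: "f (?\<kappa> k) \<in> P'" using bij_betwE[OF f] \<kappa>P[OF k] by blast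
    have gk: "color_action G c g k \<in> ?C" "?\<kappa> (color_action G c g k) = g <#\<^bsub>G\<^esub> ?\<kappa> k"
      using color_class_color_action[OF c k] closed[OF g \<kappa>P[OF k]] by auto
    have gF: "color_action G' c' (\<phi> g) (?F k) \<in> ?C'"
      "?\<kappa>' (color_action G' c' (\<phi> g) (?F k)) = \<phi> g <#\<^bsub>G'\<^esub> ?\<kappa>' (?F k)"
      using color_class_color_action[OF c' Fk, of "\<phi> g"] closed'[OF \<phi>g fB] \<kappa>'F[OF k] by auto
    \<comment> \<open>The two colors are compared through their classes, where the claim is the
      given equivariance of \<open>f\<close>; injectivity of the class map then returns to
      colors.\<close>
    have "?\<kappa>' (color_action G' c' (\<phi> g) (?F k)) = \<phi> g <#\<^bsub>G'\<^esub> f (?\<kappa> k)"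
      using gF \<kappa>'F[OF k] by simp
    also have "\<dots> = f (g <#\<^bsub>G\<^esub> ?\<kappa> k)"
      using eq[OF g \<kappa>P[OF k]] fB \<kappa>P[OF k] by (simp add: left_mult_action_def)
    also have "\<dots> = ?\<kappa>' (?F (color_action G c g k))"
      using \<kappa>'F[OF gk(1)] gk(2) by simp
    finally show "color_action G' c' (\<phi> g) (?F k) = ?F (color_action G c g k)"
      using \<kappa>' gF(1) bij_betwE[OF F] gk(1) by (metis bij_betw_def inj_onD)
  qed
  then show ?thesis by blast
qed

section \<open>Coset partitions under isomorphisms\<close>

context group_hom
begin

lemma image_l_coset:
  assumes "g \<in> carrier G" "B \<subseteq> carrier G"
  shows "h ` (g <#\<^bsub>G\<^esub> B) = h g <#\<^bsub>H\<^esub> h ` B"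
  using assms by (force simp: l_coset_def image_iff subset_iff)

lemma image_r_coset:
  assumes "g \<in> carrier G" "B \<subseteq> carrier G"
  shows "h ` (B #>\<^bsub>G\<^esub> g) = h ` B #>\<^bsub>H\<^esub> h g"
  using assms by (force simp: r_coset_def image_iff subset_iff)

lemma image_set_mult:
  assumes "A \<subseteq> carrier G" "B \<subseteq> carrier G"
  shows "h ` (A <#>\<^bsub>G\<^esub> B) = h ` A <#>\<^bsub>H\<^esub> h ` B"
  using set_mult_hom[OF homh assms] .

lemma image_rcosets:
  assumes surj: "h ` carrier G = carrier H" and K: "K \<subseteq> carrier G"
  shows "rcosets\<^bsub>H\<^esub> (h ` K) = (`) h ` (rcosets\<^bsub>G\<^esub> K)"
proof -
  have "rcosets\<^bsub>H\<^esub> (h ` K) = (\<lambda>g. h ` K #>\<^bsub>H\<^esub> h g) ` carrier G"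
    unfolding RCOSETS_def surj[symmetric] by auto
  also have "\<dots> = (\<lambda>g. h ` (K #>\<^bsub>G\<^esub> g)) ` carrier G"
    using image_r_coset K by (intro image_cong) auto
  finally show ?thesis unfolding RCOSETS_def by auto
qed

end

lemma coset_partition_dataD:
  assumes "coset_partition_data G H I Y J" "i \<in> I"
  shows "Y i \<subseteq> carrier G" and "J i \<subseteq> H"
proof -
  show "Y i \<subseteq> carrier G"
    using assms by (auto simp: coset_partition_data_def complete_right_coset_reps_def)
  have "subgroup (J i) (G\<lparr>carrier := H\<rparr>)"
    using assms by (simp add: coset_partition_data_def)
  then show "J i \<subseteq> H" using subgroup.subset by fastforce
qed

lemma coset_partition_subset:
  assumes "group G" "subgroup H G" "coset_partition_data G H I Y J" "B \<in> coset_partition G H I Y J"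
  shows "B \<subseteq> carrier G"
proof -
  interpret group G by fact
  obtain i h where ih: "i \<in> I" "h \<in> H" "B = h <#\<^bsub>G\<^esub> (J i <#>\<^bsub>G\<^esub> Y i)"
    using assms(4) by (auto simp: coset_partition_def)
  have "J i \<subseteq> carrier G" "h \<in> carrier G"
    using coset_partition_dataD[OF assms(3) ih(1)] subgroup.subset[OF assms(2)] ih(2) by auto
  then show ?thesis
    using coset_partition_dataD[OF assms(3) ih(1)] ih by (simp add: l_coset_subset_G set_mult_closed)
qed

text \<open>Translating the block with parameter \<open>h\<close> by \<open>g\<close> only changes
  the parameter to the product of \<open>g\<close> and \<open>h\<close>, which stays in
  \<open>H\<close>. This is what makes \<open>H\<close> act on the blocks.\<close>

lemma coset_partition_closed:
  assumes "group G" and H: "subgroup H G" and "coset_partition_data G H I Y J"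
    and "B \<in> coset_partition G H I Y J" and g: "g \<in> H"
  shows "g <#\<^bsub>G\<^esub> B \<in> coset_partition G H I Y J"
proof -
  interpret group G by fact
  obtain i h where ih: "i \<in> I" "h \<in> H" "B = h <#\<^bsub>G\<^esub> (J i <#>\<^bsub>G\<^esub> Y i)"
    using assms(4) by (auto simp: coset_partition_def)
  have "J i <#>\<^bsub>G\<^esub> Y i \<subseteq> carrier G"
    using coset_partition_dataD[OF assms(3) ih(1)] subgroup.subset[OF H] by (simp add: set_mult_closed)
  then have "g <#\<^bsub>G\<^esub> B = (g \<otimes>\<^bsub>G\<^esub> h) <#\<^bsub>G\<^esub> (J i <#>\<^bsub>G\<^esub> Y i)"
    using ih g subgroup.mem_carrier[OF H] by (simp add: lcos_m_assoc)
  then show ?thesis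
    using ih(1) subgroup.m_closed[OF H g ih(2)] by (auto simp: coset_partition_def)
qed

text \<open>Here \<open>G\<close> and \<open>H\<close> are the source and target groups and
  \<open>h\<close> is the map; the distinguished subgroup is called \<open>K\<close>. Stating the
  results for a general isomorphism isolates what the conjugation argument uses.\<close>

locale group_iso = group_hom +
  assumes bij: "bij_betw h (carrier G) (carrier H)"
begin

lemma surj_h: "h ` carrier G = carrier H" and inj_h: "inj_on h (carrier G)"
  using bij by (auto simp: bij_betw_def)

lemma inj_on_image: "inj_on ((`) h) (Pow (carrier G))"
  using inj_h by (rule inj_on_image_Pow)

lemma iso_restrict:
  assumes "K \<subseteq> carrier G"
  shows "h \<in> iso (G\<lparr>carrier := K\<rparr>) (H\<lparr>carrier := h ` K\<rparr>)"
  using assms inj_h by (auto simp: iso_def hom_def bij_betw_def subset_iff inj_on_subset)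

text \<open>Injectivity makes images commute with intersections. This preserves disjointness of the
  \<open>Y i\<close> and, applied to the meeting of the representatives with a coset, existence and
  uniqueness of the representative.\<close>

lemma coset_partition_data_image:
  assumes K: "subgroup K G" and data: "coset_partition_data G K I Y J"
  shows "coset_partition_data H (h ` K) I (\<lambda>i. h ` Y i) (\<lambda>i. h ` J i)"
  unfolding coset_partition_data_def complete_right_coset_reps_def
proof (intro conjI ballI)
  have Y: "Y i \<subseteq> carrier G" if "i \<in> I" for i using coset_partition_dataD(1)[OF data that] .
  have KG: "K \<subseteq> carrier G" using K by (rule subgroup.subset)
  then show "(\<Union>i\<in>I. h ` Y i) \<subseteq> carrier H" using Y by (auto simp: subset_iff)
  show "disjoint_family_on (\<lambda>i. h ` Y i) I"
    unfolding disjoint_family_on_def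
  proof (intro ballI impI)
    fix i j assume ij: "i \<in> I" "j \<in> I" "i \<noteq> j"
    then have "Y i \<inter> Y j = {}"
      using data by (auto simp: coset_partition_data_def disjoint_family_on_def)
    then show "h ` Y i \<inter> h ` Y j = {}"
      using inj_on_image_Int[OF inj_h Y[OF ij(1)] Y[OF ij(2)]] by simp
  qed
  fix i assume i: "i \<in> I"
  \<comment> \<open>Each \<open>J i\<close> is a subgroup of \<open>K\<close> rather than of
    \<open>G\<close>, so its image is taken under the restriction of \<open>h\<close> to
    \<open>K\<close>.\<close>
  interpret K: group_hom "G\<lparr>carrier := K\<rparr>" "H\<lparr>carrier := h ` K\<rparr>" h
    using K subgroup_img_is_subgroup[OF K] iso_restrict[OF KG]
    by (simp add: group_hom_def group_hom_axioms_def G.subgroup_imp_group H.subgroup_imp_group iso_def)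
  show "subgroup (h ` J i) (H\<lparr>carrier := h ` K\<rparr>)"
    using data i K.subgroup_img_is_subgroup by (simp add: coset_partition_data_def)
next
  fix C assume "C \<in> rcosets\<^bsub>H\<^esub> (h ` K)"
  then obtain D where D: "D \<in> rcosets\<^bsub>G\<^esub> K" "C = h ` D"
    using image_rcosets[OF surj_h subgroup.subset[OF K]] by auto
  let ?Y = "\<Union>i\<in>I. Y i"
  have ex1: "\<exists>!y. y \<in> ?Y \<and> y \<in> D" and Y: "?Y \<subseteq> carrier G"
    using data D(1) unfolding coset_partition_data_def complete_right_coset_reps_def by blast+
  \<comment> \<open>Unique existence is recast as a singleton intersection, a form that passes
    directly through the image.\<close>
  from ex1 obtain y where y: "?Y \<inter> D = {y}" by blast
  have DG: "D \<subseteq> carrier G"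
    using D(1) G.rcosets_part_G[OF K] by auto
  have "h ` ?Y \<inter> h ` D = {h y}"
    using inj_on_image_Int[OF inj_h Y DG] y by simp
  then show "\<exists>!y. y \<in> (\<Union>i\<in>I. h ` Y i) \<and> y \<in> C"
    unfolding D(2) image_UN by (metis IntI IntD1 IntD2 singletonD singletonI)
qed

text \<open>A homomorphism commutes with translates and with products of subsets, so it carries each
  block to the block built from the image data with the same index.\<close>

lemma coset_partition_image:
  assumes K: "subgroup K G" and data: "coset_partition_data G K I Y J"
  shows "coset_partition H (h ` K) I (\<lambda>i. h ` Y i) (\<lambda>i. h ` J i) =
    (`) h ` coset_partition G K I Y J"
proof -
  have eq: "h g <#\<^bsub>H\<^esub> (h ` J i <#>\<^bsub>H\<^esub> h ` Y i) = h ` (g <#\<^bsub>G\<^esub> (J i <#>\<^bsub>G\<^esub> Y i))"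
    if "i \<in> I" "g \<in> K" for i g
  proof -
    have "J i \<subseteq> carrier G" "Y i \<subseteq> carrier G" "g \<in> carrier G"
      using coset_partition_dataD[OF data that(1)] subgroup.subset[OF K] that(2) by auto
    then show ?thesis by (simp add: image_l_coset image_set_mult G.set_mult_closed)
  qed
  show ?thesis
  proof (intro equalityI subsetI)
    fix B assume "B \<in> coset_partition H (h ` K) I (\<lambda>i. h ` Y i) (\<lambda>i. h ` J i)"
    then obtain i g where "i \<in> I" "g \<in> K" "B = h ` (g <#\<^bsub>G\<^esub> (J i <#>\<^bsub>G\<^esub> Y i))"
      using eq by (auto simp: coset_partition_def)
    then show "B \<in> (`) h ` coset_partition G K I Y J"
      unfolding coset_partition_def by blast
  next
    fix B assume "B \<in> (`) h ` coset_partition G K I Y J"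
    then obtain i g where "i \<in> I" "g \<in> K" "B = h ` (g <#\<^bsub>G\<^esub> (J i <#>\<^bsub>G\<^esub> Y i))"
      by (auto simp: coset_partition_def)
    then show "B \<in> coset_partition H (h ` K) I (\<lambda>i. h ` Y i) (\<lambda>i. h ` J i)"
      unfolding coset_partition_def using eq by blast
  qed
qed

text \<open>Translation by \<open>h g\<close> on images corresponds to translation by
  \<open>g\<close>. Taking images is injective on subsets of the carrier, so invariance under
  \<open>g\<close> is reflected as well as preserved, and surjectivity covers every element of the
  target.\<close>

lemma perfect_image:
  assumes P: "P \<subseteq> Pow (carrier G)"
  shows "perfect H ((`) h ` P) \<longleftrightarrow> perfect G P"
proof -
  have "(\<lambda>B. h g <#\<^bsub>H\<^esub> B) ` (`) h ` P = (`) h ` P \<longleftrightarrow> (\<lambda>B. g <#\<^bsub>G\<^esub> B) ` P = P"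
    if g: "g \<in> carrier G" for g
  proof -
    have "(\<lambda>B. h g <#\<^bsub>H\<^esub> B) ` (`) h ` P = (`) h ` (\<lambda>B. g <#\<^bsub>G\<^esub> B) ` P"
      unfolding image_image using P g by (intro image_cong refl) (rule image_l_coset[symmetric], auto)
    moreover have "(\<lambda>B. g <#\<^bsub>G\<^esub> B) ` P \<subseteq> Pow (carrier G)"
      using P g G.l_coset_subset_G by blast
    ultimately show ?thesis using inj_on_image_eq_iff[OF inj_on_image _ P] by simp
  qed
  then show ?thesis unfolding perfect_def surj_h[symmetric] by simp
qed

lemma equivalent_left_mult_actions:
  assumes K: "subgroup K G" and P: "P \<subseteq> Pow (carrier G)"
    and closed: "\<And>g B. g \<in> K \<Longrightarrow> B \<in> P \<Longrightarrow> g <#\<^bsub>G\<^esub> B \<in> P"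
  shows "equivalent_actions_via (G\<lparr>carrier := K\<rparr>) P (left_mult_action G P)
    (H\<lparr>carrier := h ` K\<rparr>) ((`) h ` P) (left_mult_action H ((`) h ` P)) h ((`) h)"
proof (rule equivalent_actions_viaI)
  show "group_action (G\<lparr>carrier := K\<rparr>) P (left_mult_action G P)"
    using P closed by (intro G.group_action_left_mult K) auto
  show "group (H\<lparr>carrier := h ` K\<rparr>)"
    using subgroup_img_is_subgroup[OF K] by (rule H.subgroup_imp_group)
  show "h \<in> iso (G\<lparr>carrier := K\<rparr>) (H\<lparr>carrier := h ` K\<rparr>)"
    using K by (intro iso_restrict subgroup.subset)
  show "bij_betw ((`) h) P ((`) h ` P)"
    using inj_on_image P by (simp add: bij_betw_def inj_on_subset)
  show "left_mult_action H ((`) h ` P) g \<in> extensional ((`) h ` P)" for g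
    by (simp add: left_mult_action_def)
  fix g B assume "g \<in> carrier (G\<lparr>carrier := K\<rparr>)" "B \<in> P"
  then show "left_mult_action H ((`) h ` P) (h g) (h ` B) = h ` left_mult_action G P g B"
    using P subgroup.mem_carrier[OF K] by (auto simp: left_mult_action_def image_l_coset subset_iff)
qed

end

section \<open>Conjugation by an element of the normalizer\<close>

text \<open>Rewriting the product of cosets as an image under conjugation brings the problem into
  the form treated in \<open>group_iso\<close>.\<close>

lemma conj_set_eq_image: "conj_set E a = (`) (conj_elt E a)"
  by (auto simp: fun_eq_iff conj_set_def conj_elt_def l_coset_def r_coset_def)

text \<open>The normalizer is the stabilizer of \<open>N\<close> under conjugation of subsets, so it
  gives equality with \<open>N\<close> and not just an inclusion. This equality later supplies
  surjectivity.\<close>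

lemma (in group) normalizerD:
  assumes "a \<in> normalizer G N" "N \<subseteq> carrier G"
  shows "a \<in> carrier G" and "conj_set G a N = N"
  using assms by (auto simp: normalizer_def stabilizer_def conj_set_def)

lemma (in group) conj_elt_group_iso:
  assumes N: "subgroup N G" and a: "a \<in> normalizer G N"
  shows "group_iso (G\<lparr>carrier := N\<rparr>) (G\<lparr>carrier := N\<rparr>) (conj_elt G a)"
proof -
  note NG = subgroup.subset[OF N]
  note aG = normalizerD(1)[OF a NG] and img = normalizerD(2)[OF a NG, unfolded conj_set_eq_image]
  have mult: "conj_elt G a (x \<otimes> y) = conj_elt G a x \<otimes> conj_elt G a y"
    if "x \<in> carrier G" "y \<in> carrier G" for x y
    using aG that by (simp add: conj_elt_def m_assoc inv_solve_left)
  have inj: "inj_on (conj_elt G a) N"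
    by (rule inj_onI) (use NG aG in \<open>auto simp: conj_elt_def subset_iff\<close>)
  have "conj_elt G a \<in> hom (G\<lparr>carrier := N\<rparr>) (G\<lparr>carrier := N\<rparr>)"
    using mult NG img by (auto simp: hom_def subset_iff)
  then show ?thesis
    using inj img subgroup_imp_group[OF N]
    by (simp add: group_iso_def group_iso_axioms_def group_hom_def group_hom_axioms_def bij_betw_def)
qed

section \<open>Translates of a fundamental domain\<close>

lemma carrier_isom_groupD:
  assumes "f \<in> carrier isom_group"
  shows "bij f" and "dist (f x) (f y) = dist x y"
  using assms by (auto simp: isom_group_def)

lemma mult_isom_group [simp]: "f \<otimes>\<^bsub>isom_group\<^esub> g = f \<circ> g"
  by (simp add: isom_group_def)

text \<open>A bijective isometry and its inverse are both continuous, so it is a homeomorphism; each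
  inclusion follows from maximality of the interior.\<close>

lemma interior_isom_image:
  fixes f :: "real^'n \<Rightarrow> real^'n"
  assumes f: "f \<in> carrier isom_group"
  shows "interior (f ` S) = f ` interior S"
proof -
  note bij = carrier_isom_groupD(1)[OF f]
  have cont: "continuous_on UNIV g" if "\<And>x y. dist (g x) (g y) = dist x y"
    for g :: "real^'n \<Rightarrow> real^'n"
    using that by (auto simp: continuous_on_iff)
  let ?g = "inv_into UNIV f"
  have "dist (?g x) (?g y) = dist x y" for x y
    using carrier_isom_groupD(2)[OF f, of "?g x" "?g y"] bij
    by (simp add: bij_is_surj surj_f_inv_f)
  then have "continuous_on UNIV ?g" by (rule cont)
  moreover have "f ` T = ?g -` T" for T
    using bij_vimage_eq_inv_image[OF bij_imp_bij_inv[OF bij]] by (simp add: inv_inv_eq[OF bij])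
  ultimately have op: "open (f ` T)" if "open T" for T
    using that by (simp add: open_vimage)
  show ?thesis
  proof
    show "f ` interior S \<subseteq> interior (f ` S)"
      by (intro interior_maximal image_mono interior_subset op open_interior)
    have "open (f -` interior (f ` S))"
      using carrier_isom_groupD(2)[OF f] by (intro open_vimage cont) simp_all
    moreover have "f -` interior (f ` S) \<subseteq> S"
      using bij_is_inj[OF bij] interior_subset by (metis inj_vimage_image_eq vimage_mono)
    ultimately have "f -` interior (f ` S) \<subseteq> interior S" by (rule interior_maximal[rotated])
    then show "interior (f ` S) \<subseteq> f ` interior S"
      using bij_is_surj[OF bij] by (metis image_mono surj_image_vimage_eq)
  qed
qed

text \<open>Disjointness is known only for interiors, so an equality of translates is passed to the
  interiors first. These are nonempty, hence cannot coincide for different group elements.\<close>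

lemma fundamental_domain_bij_betw:
  assumes G: "G \<subseteq> carrier isom_group" and D: "fundamental_domain G D"
  shows "bij_betw (\<lambda>g. g ` D) G ((\<lambda>g. g ` D) ` G)"
proof (rule bij_betwI'[where X = G])
  fix g h assume gh: "g \<in> G" "h \<in> G"
  show "g ` D = h ` D \<longleftrightarrow> g = h"
  proof
    assume "g ` D = h ` D"
    then have "g ` interior D = h ` interior D"
      using interior_isom_image gh G by (metis subsetD)
    moreover have "g ` interior D \<noteq> {}" using D by (simp add: fundamental_domain_def)
    ultimately show "g = h" using D gh by (force simp: fundamental_domain_def)
  qed simp
qed auto

text \<open>The inverse of \<open>\<alpha>\<close> also fixes \<open>D\<close> as a set, so the
  rightmost factor of the conjugate disappears when applied to \<open>D\<close>.\<close>

lemma conj_elt_isom_image: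
  assumes a: "\<alpha> \<in> carrier isom_group" and D: "\<alpha> ` D = D"
  shows "conj_elt isom_group \<alpha> g ` D = \<alpha> ` g ` D"
proof -
  let ?b = "inv\<^bsub>isom_group\<^esub> \<alpha>"
  have "?b \<circ> \<alpha> = id"
    using group.l_inv[OF group_isom_group a] by (simp add: isom_group_def)
  then have "?b ` \<alpha> ` D = D" by (metis image_comp image_id id_apply)
  then have "?b ` D = D" using D by simp
  then show ?thesis by (simp only: conj_elt_def mult_isom_group image_comp[symmetric])
qed

section \<open>The three claims, obtained by specializing to conjugation by \<open>\<alpha>\<close>
  on \<open>G\<close>\<close>

theorem theorem7:
  fixes \<Gamma> G H H' :: "(real^'n \<Rightarrow> real^'n) set" and \<alpha> :: "real^'n \<Rightarrow> real^'n"
  assumes "crystallographic \<Gamma>"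
    and "subgroup G (isom_sub \<Gamma>)"
    and "subgroup H (isom_sub G)" and "card (rcosets\<^bsub>isom_sub G\<^esub> H) = 2"
    and "subgroup H' (isom_sub G)" and "card (rcosets\<^bsub>isom_sub G\<^esub> H') = 2"
    and "\<alpha> \<in> normalizer isom_group G"
    and "H' = conj_set isom_group \<alpha> H"
  shows
    "(\<forall>D. fundamental_domain G D \<and> \<alpha> ` D = D \<longrightarrow>
        bij_betw (\<lambda>g. g ` D) G {g ` D | g. g \<in> G} \<and>
        bij_betw (\<lambda>T. \<alpha> ` T) {g ` D | g. g \<in> G} {g ` D | g. g \<in> G} \<and>
        bij_betw (conj_elt isom_group \<alpha>) G G \<and>
        (\<forall>g\<in>G. \<alpha> ` (g ` D) = conj_elt isom_group \<alpha> g ` D)) \<and>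
     (\<forall>(I :: 'i set) Y J P P'.
        coset_partition_data (isom_sub G) H I Y J \<and>
        P = coset_partition (isom_sub G) H I Y J \<and>
        P' = coset_partition (isom_sub G) H' I
               (\<lambda>i. conj_set isom_group \<alpha> (Y i)) (\<lambda>i. conj_set isom_group \<alpha> (J i)) \<longrightarrow>
        coset_partition_data (isom_sub G) H' I
          (\<lambda>i. conj_set isom_group \<alpha> (Y i)) (\<lambda>i. conj_set isom_group \<alpha> (J i)) \<and>
        P' = conj_set isom_group \<alpha> ` P \<and>
        (perfect (isom_sub G) P \<longleftrightarrow> perfect (isom_sub G) P') \<and>
        equivalent_actions_via
          (isom_sub H) P (left_mult_action (isom_sub G) P)
          (isom_sub H') P' (left_mult_action (isom_sub G) P')
          (conj_elt isom_group \<alpha>) (conj_set isom_group \<alpha>) \<and>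
        (\<forall>(c :: _ \<Rightarrow> 'c) (c' :: _ \<Rightarrow> 'd).
           coloring_of (isom_sub G) P c \<and> coloring_of (isom_sub G) P' c' \<longrightarrow>
           (\<exists>F. equivalent_actions_via
                  (isom_sub H) (c ` G) (color_action (isom_sub G) c)
                  (isom_sub H') (c' ` G) (color_action (isom_sub G) c')
                  (conj_elt isom_group \<alpha>) F)))"
proof -
  interpret E: group "isom_group :: (real^'n \<Rightarrow> real^'n) monoid" by (rule group_isom_group)
  let ?\<phi> = "conj_elt isom_group \<alpha>"
  have "subgroup \<Gamma> isom_group" using assms(1) by (simp add: crystallographic_def)
  then have G: "subgroup G isom_group"
    using assms(2) E.incl_subgroup by blast
  note GE = subgroup.subset[OF G]
  have \<alpha>: "\<alpha> \<in> carrier isom_group" using E.normalizerD(1)[OF assms(7) GE] .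
  interpret \<phi>: group_iso "isom_sub G" "isom_sub G" ?\<phi>
    using G assms(7) by (rule E.conj_elt_group_iso)
  have H': "H' = ?\<phi> ` H" using assms(8) by (simp add: conj_set_eq_image)
  note H = assms(3)
  have a: "bij_betw (\<lambda>g. g ` D) G {g ` D | g. g \<in> G} \<and>
      bij_betw (\<lambda>T. \<alpha> ` T) {g ` D | g. g \<in> G} {g ` D | g. g \<in> G} \<and>
      bij_betw ?\<phi> G G \<and> (\<forall>g\<in>G. \<alpha> ` (g ` D) = ?\<phi> g ` D)"
    if D: "fundamental_domain G D" "\<alpha> ` D = D" for D
  proof -
    have set: "{g ` D | g. g \<in> G} = (\<lambda>g. g ` D) ` G" by auto
    have b\<phi>: "bij_betw ?\<phi> G G" using \<phi>.bij by simp
    have conj: "\<alpha> ` (g ` D) = ?\<phi> g ` D" for g using conj_elt_isom_image[OF \<alpha> D(2)] by simp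
    \<comment> \<open>Moving translates by \<open>\<alpha>\<close> amounts to reindexing them by
      conjugation, and conjugation maps \<open>G\<close> onto itself; so \<open>\<alpha>\<close>
      maps the family of translates onto itself.\<close>
    have "(\<lambda>T. \<alpha> ` T) ` (\<lambda>g. g ` D) ` G = (\<lambda>g. g ` D) ` ?\<phi> ` G"
      by (simp only: image_image[of "image \<alpha>" "\<lambda>g. g ` D" G] image_image[of "\<lambda>g. g ` D" ?\<phi> G] conj)
    then have "(\<lambda>T. \<alpha> ` T) ` (\<lambda>g. g ` D) ` G = (\<lambda>g. g ` D) ` G"
      using b\<phi> by (simp add: bij_betw_def)
    moreover have "inj ((`) \<alpha>)"
      using carrier_isom_groupD(1)[OF \<alpha>] by (intro injI) (simp add: bij_is_inj inj_image_eq_iff)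
    ultimately have "bij_betw (\<lambda>T. \<alpha> ` T) ((\<lambda>g. g ` D) ` G) ((\<lambda>g. g ` D) ` G)"
      by (metis bij_betw_def inj_on_subset subset_UNIV)
    then show ?thesis
      using fundamental_domain_bij_betw[OF GE D(1)] b\<phi> conj unfolding set by simp
  qed
  have bc: "coset_partition_data (isom_sub G) H' I (\<lambda>i. ?\<phi> ` Y i) (\<lambda>i. ?\<phi> ` J i) \<and>
      P' = (`) ?\<phi> ` P \<and> (perfect (isom_sub G) P \<longleftrightarrow> perfect (isom_sub G) P') \<and>
      equivalent_actions_via (isom_sub H) P (left_mult_action (isom_sub G) P)
        (isom_sub H') P' (left_mult_action (isom_sub G) P') ?\<phi> ((`) ?\<phi>)"
    if data: "coset_partition_data (isom_sub G) H I Y J"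
      and P: "P = coset_partition (isom_sub G) H I Y J"
      and P': "P' = coset_partition (isom_sub G) H' I (\<lambda>i. ?\<phi> ` Y i) (\<lambda>i. ?\<phi> ` J i)"
    for I :: "'i set" and Y J P P'
  proof -
    have P'_eq: "P' = (`) ?\<phi> ` P"
      unfolding P P' H' by (rule \<phi>.coset_partition_image[OF H data])
    have sub: "P \<subseteq> Pow (carrier (isom_sub G))"
      using coset_partition_subset[OF \<phi>.G.is_group H data] unfolding P by blast
    have "g <#\<^bsub>isom_sub G\<^esub> B \<in> P" if "g \<in> H" "B \<in> P" for g B
      using coset_partition_closed[OF \<phi>.G.is_group H data] that unfolding P by blast
    from \<phi>.equivalent_left_mult_actions[OF H sub this] show ?thesis
      using \<phi>.coset_partition_data_image[OF H data] \<phi>.perfect_image[OF sub]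
      by (simp add: P'_eq H')
  qed
  have colors: "\<exists>F. equivalent_actions_via
        (isom_sub H) (c ` G) (color_action (isom_sub G) c)
        (isom_sub H') (c' ` G) (color_action (isom_sub G) c') ?\<phi> F"
    if "equivalent_actions_via (isom_sub H) P (left_mult_action (isom_sub G) P)
        (isom_sub H') P' (left_mult_action (isom_sub G) P') ?\<phi> ((`) ?\<phi>)"
      and "coloring_of (isom_sub G) P c" "coloring_of (isom_sub G) P' c'"
    for P P' and c :: "_ \<Rightarrow> 'c" and c' :: "_ \<Rightarrow> 'd"
    using equivalent_color_actions[where G = "isom_sub G" and G' = "isom_sub G" and H = H and H' = H'] that
    by simp
  show ?thesis
    unfolding conj_set_eq_image
  proof (rule conjI, intro allI impI, elim conjE, rule a, assumption, assumption,
      intro allI impI, elim conjE)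
    fix I :: "'i set" and Y J P P'
    assume "coset_partition_data (isom_sub G) H I Y J"
      and "P = coset_partition (isom_sub G) H I Y J"
      and "P' = coset_partition (isom_sub G) H' I (\<lambda>i. ?\<phi> ` Y i) (\<lambda>i. ?\<phi> ` J i)"
    note bc = bc[OF this]
    note equiv = bc[THEN conjunct2, THEN conjunct2, THEN conjunct2]
    show "coset_partition_data (isom_sub G) H' I (\<lambda>i. ?\<phi> ` Y i) (\<lambda>i. ?\<phi> ` J i) \<and>
      P' = (`) ?\<phi> ` P \<and> (perfect (isom_sub G) P \<longleftrightarrow> perfect (isom_sub G) P') \<and>
      equivalent_actions_via (isom_sub H) P (left_mult_action (isom_sub G) P)
        (isom_sub H') P' (left_mult_action (isom_sub G) P') ?\<phi> ((`) ?\<phi>) \<and>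
      (\<forall>(c :: _ \<Rightarrow> 'c) (c' :: _ \<Rightarrow> 'd).
         coloring_of (isom_sub G) P c \<and> coloring_of (isom_sub G) P' c' \<longrightarrow>
         (\<exists>F. equivalent_actions_via
                (isom_sub H) (c ` G) (color_action (isom_sub G) c)
                (isom_sub H') (c' ` G) (color_action (isom_sub G) c') ?\<phi> F))"
      using bc by (elim conjE) (intro conjI allI impI, assumption+, elim conjE, rule colors[OF equiv])
  qed
qed

end
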